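(* Let $C_1, C_2, C_3$ be three distinct points on a line with $C_2$ between $C_1$ and $C_3$. Consider the parbelos they determine, with parabolas $G_1,G_2,G_3$ (where $G_2$ is the outer parabola), tangent rectangle $C_2T_1T_2T_3$, and points $F, H, A_1, A_3$, where $F$ is the focus of $G_2$; $H$ is the intersection of the angle bisector at the cusp $C_2$ with the directrix of $G_2$; $A_1$ is the intersection of the axis of symmetry of $G_1$ with the directrix of $G_3$; and $A_3$ is the intersection of the axis of symmetry of $G_3$ with the directrix of $G_1$. Then: 1. The focus $F$ of the outer parabola is equidistant from the vertices $T_1$ and $T_3$ of the tangent rectangle. 2. The point $H$ lies on the circle through $F, C_2, T_1, T_2, T_3$, which is the circumcircle of the tangent rectangle. 3. The point $H$ is equidistant from the vertices $T_1$ and $T_3$. 4. The points $A_1$ and $A_3$ lie on the circle through $F, C_2, T_1, T_2, T_3$. 5. The point $A_1$ is equidistant from $C_2$ and $T_2$, and so is the point $A_3$.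
   Context: All objects lie in the Euclidean plane. The latus rectum of a parabola is the chord through its focus parallel to its directrix. Given distinct points $C_1,C_2,C_3$ on a line with $C_2$ between $C_1$ and $C_3$, let $G_1, G_2, G_3$ be the parabolas that open in the same direction (perpendicular to the line $C_1C_3$, on the same side) and whose latera recta are the segments $C_1C_2$, $C_1C_3$, $C_2C_3$, respectively. The parbelos is the region bounded by the three latus rectum arcs, i.e. the arcs of $G_1,G_2,G_3$ cut off by their latera recta. $G_2$ is called the outer or upper parabola, and $C_1,C_2,C_3$ are the cusps. The tangent line of a parabola at either endpoint of its latus rectum makes an angle $\pi/4$ with the latus rectum, so $G_1$ and $G_2$ have a common tangent line $t_1$ at $C_1$, and $G_2$ and $G_3$ have a common tangent line $t_3$ at $C_3$. Let $m_1$ be the tangent line to $G_1$ at $C_2$ and $m_3$ the tangent line to $G_3$ at $C_2$. The four lines $t_1,t_3,m_1,m_3$ bound a rectangle, called the tangent rectangle, with vertices $C_2$, $T_1 = t_1\cap m_1$, $T_2 = t_1\cap t_3$, $T_3 = t_3\cap m_3$. The angle bisector at the cusp $C_2$ is the internal bisector of the angle $\angle T_1C_2T_3$. The directrix of $G_3$ is the line parallel to $C_1C_3$ through $T_3$, and the directrix of $G_1$ is the line parallel to $C_1C_3$ through $T_1$. *)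

theory Defs
  imports "HOL-Analysis.Analysis"
begin

type_synonym point = "real ^ 2"

definition is_line :: "point set \<Rightarrow> bool" where
  "is_line L \<longleftrightarrow> affine L \<and> aff_dim L = 1"

definition is_circle :: "point set \<Rightarrow> bool" where
  "is_circle \<Gamma> \<longleftrightarrow> (\<exists>c r. r > 0 \<and> \<Gamma> = sphere c r)"

definition orthogonal_to_line :: "point \<Rightarrow> point set \<Rightarrow> bool" where
  "orthogonal_to_line v L \<longleftrightarrow> (\<forall>p\<in>L. \<forall>q\<in>L. orthogonal v (p - q))"

definition is_parabola :: "point set \<Rightarrow> point \<Rightarrow> point set \<Rightarrow> bool" where
  "is_parabola G F d \<longleftrightarrow> is_line d \<and> F \<notin> d \<and> G = {X. dist X F = infdist X d}"

(* A parabola opens from its directrix towards its focus. *)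
definition opens_towards :: "point \<Rightarrow> point set \<Rightarrow> point \<Rightarrow> bool" where
  "opens_towards F d u \<longleftrightarrow> orthogonal_to_line u d \<and> (\<forall>q\<in>d. u \<bullet> (F - q) > 0)"

definition is_latus_rectum :: "point set \<Rightarrow> point set \<Rightarrow> point \<Rightarrow> point set \<Rightarrow> bool" where
  "is_latus_rectum S G F d \<longleftrightarrow>
     (\<exists>A B. A \<noteq> B \<and> A \<in> G \<and> B \<in> G \<and> S = closed_segment A B \<and>
            F \<in> S \<and> affine_parallel (affine hull {A, B}) d)"

definition axis_of_symmetry :: "point \<Rightarrow> point set \<Rightarrow> point set" where
  "axis_of_symmetry F d = {X. orthogonal_to_line (X - F) d}"

(* The tangent as the limit of secants: the sine of the angle between L and the
   secant through P and X, which is infdist X L / dist X P, tends to 0 as X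
   approaches P along G. *)
definition is_tangent :: "point set \<Rightarrow> point set \<Rightarrow> point \<Rightarrow> bool" where
  "is_tangent L G P \<longleftrightarrow> is_line L \<and> P \<in> L \<and> P \<in> G \<and> P islimpt G \<and>
     ((\<lambda>X. infdist X L / dist X P) \<longlongrightarrow> 0) (at P within G)"

definition angle_at :: "point \<Rightarrow> point \<Rightarrow> point \<Rightarrow> real" where
  "angle_at A V B = arccos (((A - V) \<bullet> (B - V)) / (norm (A - V) * norm (B - V)))"

(* The internal bisector as a ray, vertex included. For a straight angle this
   would be a whole line, but here it is only used for a right angle. *)
definition internal_bisector :: "point \<Rightarrow> point \<Rightarrow> point \<Rightarrow> point set" where
  "internal_bisector A V B =
     insert V {X. angle_at A V X = angle_at A V B / 2 \<and> angle_at X V B = angle_at A V B / 2}"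

end

theory Submission
  imports Defs
begin

text \<open>
  Everything becomes explicit in an orthonormal frame with origin \<open>C2\<close>, first axis along the line of
  the cusps and second axis in the opening direction. Write \<open>2a\<close> and \<open>2b\<close> for the lengths of the two
  inner latera recta, so that the cusps are \<open>(-2a, 0)\<close>, \<open>(0, 0)\<close>, \<open>(2b, 0)\<close>. A latus rectum of length
  \<open>2k\<close> and the opening direction determine the parabola: the focus is the midpoint of the latus rectum
  and the directrix lies at depth \<open>k\<close> below it (\<open>parabola_from_latus_rectum\<close>). The tangents at the
  endpoints of a latus rectum have slopes \<open>-1\<close> and \<open>1\<close> (\<open>tangent_at_latus_rectum_end\<close>). Hence
  \<open>T1 = (-a, -a)\<close>, \<open>T3 = (b, -b)\<close>, \<open>T2 = (b - a, -a - b)\<close>, and the internal bisector of the right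
  angle at \<open>C2\<close> is the negative second axis (\<open>internal_bisector_right_angle\<close>). The remaining points are
  \<open>F2 = (b - a, 0)\<close>, \<open>H = (0, -a - b)\<close>, \<open>A1 = (-a, -b)\<close>, \<open>A3 = (b, -a)\<close>.

  The circle with diameter \<open>T1 T3\<close> has the equation \<open>x\<^sup>2 + y\<^sup>2 = (b - a) x - (a + b) y\<close>, which all
  these points satisfy. It also has the diameter \<open>C2 T2\<close>, because both are diagonals of the rectangle.
  The claims on distances say that \<open>F2\<close> and \<open>H\<close> lie on the perpendicular bisector of \<open>T1 T3\<close>, and
  \<open>A1\<close> and \<open>A3\<close> on that of \<open>C2 T2\<close>; in coordinates they are identities.

  The step with analytic content is the passage from the tangent as a limit of secants to an equation
  of a line. It rests on \<open>tangent_eq_velocity_line\<close>.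
\<close>

section \<open>Tangent lines and velocities\<close>

text \<open>
  The homothety with centre \<open>P\<close> and ratio \<open>1/s\<close> maps \<open>L\<close> to itself and the point \<open>P + s w(s)\<close> of the
  curve to \<open>P + w(s)\<close>. So the distance of \<open>P + w(s)\<close> from \<open>L\<close> is the sine of the angle between secant
  and tangent, times the length of \<open>w(s)\<close>, and tends to \<open>0\<close>. By continuity \<open>P + v\<close> has distance \<open>0\<close>
  from \<open>L\<close>. The curve is given through its difference quotient \<open>w\<close>, whose limit \<open>v\<close> at \<open>0\<close> is the
  velocity.
\<close>

lemma tangent_eq_velocity_line:
  fixes w :: "real \<Rightarrow> point"
  assumes tan: "is_tangent L G P"
    and curve: "\<And>s. P + s *\<^sub>R w s \<in> G"
    and vel: "(w \<longlongrightarrow> v) (at 0)" and "v \<noteq> 0"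
  shows "L = range (\<lambda>r. P + r *\<^sub>R v)"
proof -
  have aff: "affine L" and dim: "aff_dim L = 1" and PL: "P \<in> L"
    and lim: "((\<lambda>X. infdist X L / dist X P) \<longlongrightarrow> 0) (at P within G)"
    using tan by (auto simp: is_tangent_def is_line_def)
  have closed: "closed L"
    using aff by (rule affine_closed)
  have w_ne: "eventually (\<lambda>s. s \<noteq> 0 \<and> w s \<noteq> 0) (at 0)"
    using tendsto_imp_eventually_ne[OF vel \<open>v \<noteq> 0\<close>]
    by (auto simp: eventually_conj_iff eventually_at_filter)
  have "((\<lambda>s. P + s *\<^sub>R w s) \<longlongrightarrow> P + 0 *\<^sub>R v) (at 0)"
    by (intro tendsto_intros vel)
  then have "filterlim (\<lambda>s. P + s *\<^sub>R w s) (at P within G) (at 0)"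
    unfolding filterlim_at using w_ne curve by (auto elim!: eventually_mono)
  then have "((\<lambda>s. infdist (P + s *\<^sub>R w s) L / dist (P + s *\<^sub>R w s) P) \<longlongrightarrow> 0) (at 0)"
    by (rule filterlim_compose[OF lim])
  then have "((\<lambda>s. infdist (P + s *\<^sub>R w s) L / dist (P + s *\<^sub>R w s) P * norm (w s)) \<longlongrightarrow> 0 * norm v) (at 0)"
    by (intro tendsto_mult tendsto_norm vel)
  then have lim0: "((\<lambda>s. infdist (P + s *\<^sub>R w s) L / dist (P + s *\<^sub>R w s) P * norm (w s)) \<longlongrightarrow> 0) (at 0)"
    by simp
  have "eventually (\<lambda>s. infdist (P + w s) L
      \<le> infdist (P + s *\<^sub>R w s) L / dist (P + s *\<^sub>R w s) P * norm (w s)) (at 0)"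
    using w_ne
  proof (eventually_elim, elim conjE)
    fix s :: real
    assume s: "s \<noteq> 0" and "w s \<noteq> 0"
    obtain Y where Y: "Y \<in> L" "infdist (P + s *\<^sub>R w s) L = dist (P + s *\<^sub>R w s) Y"
      using infdist_attains_inf[OF closed, of "P + s *\<^sub>R w s"] PL by blast
    \<comment> \<open>The image of \<open>Y\<close>, the point of \<open>L\<close> closest to the curve point, under the homothety.\<close>
    have "(1 - 1/s) *\<^sub>R P + (1/s) *\<^sub>R Y \<in> L"
      by (rule mem_affine[OF aff PL Y(1)]) simp
    then have "infdist (P + w s) L \<le> dist (P + w s) ((1 - 1/s) *\<^sub>R P + (1/s) *\<^sub>R Y)"
      by (rule infdist_le)
    also have "(P + w s) - ((1 - 1/s) *\<^sub>R P + (1/s) *\<^sub>R Y) = (1/s) *\<^sub>R ((P + s *\<^sub>R w s) - Y)"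
      using s by (simp add: algebra_simps)
    then have "dist (P + w s) ((1 - 1/s) *\<^sub>R P + (1/s) *\<^sub>R Y) = dist (P + s *\<^sub>R w s) Y / \<bar>s\<bar>"
      by (simp add: dist_norm)
    also have "\<dots> = infdist (P + s *\<^sub>R w s) L / dist (P + s *\<^sub>R w s) P * norm (w s)"
      using s \<open>w s \<noteq> 0\<close> by (simp add: Y(2) dist_norm)
    finally show "infdist (P + w s) L
      \<le> infdist (P + s *\<^sub>R w s) L / dist (P + s *\<^sub>R w s) P * norm (w s)" .
  qed
  then have "((\<lambda>s. infdist (P + w s) L) \<longlongrightarrow> 0) (at 0)"
    by (intro tendsto_sandwich[OF _ _ tendsto_const lim0]) (auto simp: infdist_nonneg)
  moreover have "((\<lambda>s. infdist (P + w s) L) \<longlongrightarrow> infdist (P + v) L) (at 0)"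
    by (intro tendsto_infdist tendsto_intros vel)
  ultimately have "infdist (P + v) L = 0"
    using tendsto_unique trivial_limit_at by blast
  then have "P + v \<in> L"
    using in_closed_iff_infdist_zero[OF closed] PL by blast
  then have "affine hull {P, P + v} \<subseteq> L"
    using PL by (intro hull_minimal aff) auto
  then have "affine hull {P, P + v} = L"
    using aff dim \<open>v \<noteq> 0\<close> by (intro affine_dim_equal) (auto simp: affine_affine_hull)
  then show ?thesis
    by (simp add: affine_hull_2_alt)
qed

section \<open>Coordinates in an orthonormal frame\<close>

locale frame =
  fixes Z e n :: point
  assumes norm_e: "norm e = 1" and norm_n: "norm n = 1" and e_n: "e \<bullet> n = 0"
begin

definition pt :: "real \<Rightarrow> real \<Rightarrow> point" where
  "pt x y = Z + x *\<^sub>R e + y *\<^sub>R n"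

lemma inner_frame: "e \<bullet> e = 1" "n \<bullet> n = 1" "e \<bullet> n = 0" "n \<bullet> e = 0"
  using norm_e norm_n e_n by (auto simp: norm_eq_1 inner_commute)

lemma inner_diff_pt:
  "(pt x y - pt x' y') \<bullet> (pt v w - pt v' w') = (x - x') * (v - v') + (y - y') * (w - w')"
proof -
  have "pt p q - pt p' q' = (p - p') *\<^sub>R e + (q - q') *\<^sub>R n" for p q p' q'
    by (simp add: pt_def algebra_simps)
  then show ?thesis
    by (simp add: inner_simps inner_frame)
qed

lemma norm_diff_pt: "norm (pt x y - pt x' y') = sqrt ((x - x')\<^sup>2 + (y - y')\<^sup>2)"
  by (simp add: norm_eq_sqrt_inner inner_diff_pt power2_eq_square)

lemma dist_pt: "dist (pt x y) (pt x' y') = sqrt ((x - x')\<^sup>2 + (y - y')\<^sup>2)"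
  by (simp add: dist_norm norm_diff_pt)

lemma pt_eq_iff [simp]: "pt x y = pt x' y' \<longleftrightarrow> x = x' \<and> y = y'"
proof -
  have "pt x y = pt x' y' \<longleftrightarrow> dist (pt x y) (pt x' y') = 0"
    by simp
  also have "\<dots> \<longleftrightarrow> x = x' \<and> y = y'"
    unfolding dist_pt by (simp add: sum_power2_eq_zero_iff)
  finally show ?thesis .
qed

lemma pt_cases: obtains x y where "X = pt x y"
proof -
  have "e \<noteq> n" "e \<noteq> 0" "n \<noteq> 0"
    using inner_frame by auto
  then have "independent {e, n}"
    by (intro pairwise_orthogonal_independent)
      (auto simp: pairwise_def orthogonal_def inner_frame)
  then have "span {e, n} = UNIV"
    using \<open>e \<noteq> n\<close> card_ge_dim_independent[of "{e, n}" UNIV] by auto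
  then obtain x where "(X - Z) - x *\<^sub>R e \<in> span {n}"
    by (metis UNIV_I span_breakdown_eq)
  then obtain y where "(X - Z) - x *\<^sub>R e = y *\<^sub>R n"
    by (auto simp: span_singleton)
  then have "X = pt x y"
    by (simp add: pt_def algebra_simps)
  then show thesis ..
qed

section \<open>Parabolas with a horizontal latus rectum\<close>

lemma affine_hull_horizontal:
  assumes "x \<noteq> x'"
  shows "affine hull {pt x h, pt x' h} = range (\<lambda>r. pt r h)"
proof -
  have *: "pt x h + t *\<^sub>R (pt x' h - pt x h) = pt (x + t * (x' - x)) h" for t
    by (simp add: pt_def algebra_simps)
  have "pt r h \<in> range (\<lambda>t. pt (x + t * (x' - x)) h)" for r
    by (rule range_eqI[of _ _ "(r - x) / (x' - x)"]) (use assms in simp)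
  then show ?thesis
    by (auto simp: affine_hull_2_alt *)
qed

lemma infdist_horizontal: "infdist (pt x y) (range (\<lambda>r. pt r h)) = \<bar>y - h\<bar>"
proof (rule antisym)
  have "infdist (pt x y) (range (\<lambda>r. pt r h)) \<le> dist (pt x y) (pt x h)"
    by (rule infdist_le) simp
  then show "infdist (pt x y) (range (\<lambda>r. pt r h)) \<le> \<bar>y - h\<bar>"
    by (simp add: dist_pt)
  show "\<bar>y - h\<bar> \<le> infdist (pt x y) (range (\<lambda>r. pt r h))"
    by (auto simp: infdist_notempty dist_pt real_le_rsqrt intro!: cINF_greatest)
qed

text \<open>
  The endpoints of the latus rectum lie on the parabola and have the same distance \<open>\<bar>h\<bar>\<close> from the
  directrix, which is a horizontal line \<open>y = h\<close>. So the focus, lying between them, is equidistant from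
  them: it is the midpoint, and \<open>\<bar>h\<bar> = k\<close>. The opening direction decides the sign of \<open>h\<close>.
\<close>

lemma parabola_from_latus_rectum:
  assumes par: "is_parabola G F d" and "k > 0"
    and lr: "is_latus_rectum (closed_segment (pt (c - k) 0) (pt (c + k) 0)) G F d"
    and opens: "opens_towards F d (l *\<^sub>R n)" and "l > 0"
  shows "F = pt c 0" and "d = range (\<lambda>x. pt x (- k))"
    and "pt x y \<in> G \<longleftrightarrow> (x - c)\<^sup>2 = 2 * k * y + k\<^sup>2"
proof -
  let ?A = "pt (c - k) 0" and ?B = "pt (c + k) 0"
  have G: "X \<in> G \<longleftrightarrow> dist X F = infdist X d" for X
    using par by (auto simp: is_parabola_def)
  obtain A B where AB: "A \<in> G" "B \<in> G" "closed_segment ?A ?B = closed_segment A B"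
    "affine_parallel (affine hull {A, B}) d" and F: "F \<in> closed_segment ?A ?B"
    using lr by (auto simp: is_latus_rectum_def)
  have ends: "{A, B} = {?A, ?B}"
    using AB(3) by (simp add: closed_segment_eq)
  then have "?A \<in> G" "?B \<in> G" "affine_parallel (range (\<lambda>r. pt r 0)) d"
    using AB \<open>k > 0\<close> affine_hull_horizontal[of "c - k" "c + k" 0] by auto
  then obtain a where a: "d = (\<lambda>X. a + X) ` range (\<lambda>r. pt r 0)"
    by (auto simp: affine_parallel_def)
  \<comment> \<open>The coordinates of the translation vector \<open>a\<close>, which carries the latus rectum line to \<open>d\<close>.\<close>
  obtain p h where ph: "Z + a = pt p h"
    by (rule pt_cases)
  have shift: "a + pt r 0 = pt (p + r) h" for r
    using ph by (simp add: pt_def algebra_simps)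
  have "pt r h \<in> (\<lambda>X. a + X) ` range (\<lambda>r. pt r 0)" for r
    using shift[of "r - p"] by (metis add.commute diff_add_cancel image_eqI rangeI)
  then have d: "d = range (\<lambda>x. pt x h)"
    by (auto simp: a shift)
  obtain t where t: "F = (1 - t) *\<^sub>R ?A + t *\<^sub>R ?B"
    using F by (auto simp: in_segment)
  define f where "f = c - k + t * (2 * k)"
  have f: "F = pt f 0"
    unfolding t f_def by (simp add: pt_def algebra_simps flip: scaleR_add_left)
  have "(l *\<^sub>R n) \<bullet> (pt f 0 - pt f h) > 0"
    using opens by (auto simp: opens_towards_def d f)
  moreover have "pt f 0 - pt f h = - (h *\<^sub>R n)"
    by (simp add: pt_def)
  ultimately have h: "h < 0"
    using \<open>l > 0\<close> by (simp add: inner_frame mult_less_0_iff)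
  have "\<bar>c - k - f\<bar> = - h" "\<bar>c + k - f\<bar> = - h"
    using \<open>?A \<in> G\<close> \<open>?B \<in> G\<close> h by (auto simp: G f d infdist_horizontal dist_pt)
  then have "f = c" "h = - k"
    using \<open>k > 0\<close> by auto
  then show "F = pt c 0" and d': "d = range (\<lambda>x. pt x (- k))"
    using f d by auto
  have "pt x y \<in> G \<longleftrightarrow> sqrt ((x - c)\<^sup>2 + y\<^sup>2) = \<bar>y + k\<bar>"
    using d' \<open>F = pt f 0\<close> \<open>f = c\<close> by (simp add: G infdist_horizontal dist_pt)
  also have "\<dots> \<longleftrightarrow> (x - c)\<^sup>2 + y\<^sup>2 = (y + k)\<^sup>2"
    by (metis real_sqrt_abs real_sqrt_eq_iff)
  also have "\<dots> \<longleftrightarrow> (x - c)\<^sup>2 = 2 * k * y + k\<^sup>2"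
    by (auto simp: power2_eq_square algebra_simps)
  finally show "pt x y \<in> G \<longleftrightarrow> (x - c)\<^sup>2 = 2 * k * y + k\<^sup>2" .
qed

text \<open>
  The sign \<open>\<sigma>\<close> selects the endpoint: \<open>-1\<close> for the left one, \<open>1\<close> for the right one; it is also the
  slope of the tangent there.
\<close>

lemma tangent_at_latus_rectum_end:
  assumes G: "\<And>x y. pt x y \<in> G \<longleftrightarrow> (x - c)\<^sup>2 = 2 * k * y + k\<^sup>2" and "k > 0"
    and \<sigma>: "\<sigma>\<^sup>2 = 1"
    and tan: "is_tangent L G (pt (c + \<sigma> * k) 0)"
  shows "pt x y \<in> L \<longleftrightarrow> y = \<sigma> * (x - c) - k"
proof -
  \<comment> \<open>Difference quotient of the parabola parametrised by the horizontal offset \<open>s\<close> from the endpoint.\<close>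
  define w where "w s = e + (\<sigma> + s / (2 * k)) *\<^sub>R n" for s
  have curve: "pt (c + \<sigma> * k) 0 + s *\<^sub>R w s = pt (c + \<sigma> * k + s) (\<sigma> * s + s\<^sup>2 / (2 * k))" for s
    by (simp add: pt_def w_def algebra_simps power2_eq_square)
  have "(c + \<sigma> * k + s - c)\<^sup>2 = 2 * k * (\<sigma> * s + s\<^sup>2 / (2 * k)) + k\<^sup>2" for s
    using \<open>k > 0\<close> \<sigma> by (simp add: power2_sum power_mult_distrib algebra_simps)
  then have on_G: "pt (c + \<sigma> * k) 0 + s *\<^sub>R w s \<in> G" for s
    unfolding curve by (simp only: G)
  have "(w \<longlongrightarrow> e + (\<sigma> + 0 / (2 * k)) *\<^sub>R n) (at 0)"
    unfolding w_def using \<open>k > 0\<close> by (intro tendsto_intros) auto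
  then have vel: "(w \<longlongrightarrow> e + \<sigma> *\<^sub>R n) (at 0)"
    by simp
  have "(e + \<sigma> *\<^sub>R n) \<bullet> e = 1"
    by (simp add: inner_simps inner_frame)
  then have "e + \<sigma> *\<^sub>R n \<noteq> 0"
    by auto
  from tangent_eq_velocity_line[OF tan on_G vel this]
  have "L = range (\<lambda>r. pt (c + \<sigma> * k) 0 + r *\<^sub>R (e + \<sigma> *\<^sub>R n))" .
  also have "\<dots> = range (\<lambda>r. pt (c + \<sigma> * k + r) (\<sigma> * r))"
    by (simp add: pt_def algebra_simps)
  finally have "pt x y \<in> L \<longleftrightarrow> (\<exists>r. x = c + \<sigma> * k + r \<and> y = \<sigma> * r)"
    by auto
  also have "\<dots> \<longleftrightarrow> y = \<sigma> * (x - c - \<sigma> * k)"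
    by (auto intro: exI[of _ "x - c - \<sigma> * k"])
  also have "\<sigma> * (x - c - \<sigma> * k) = \<sigma> * (x - c) - k"
    using \<sigma> by (simp add: algebra_simps power2_eq_square)
  finally show ?thesis .
qed

lemma axis_of_symmetry_horizontal:
  "pt x y \<in> axis_of_symmetry (pt f g) (range (\<lambda>r. pt r h)) \<longleftrightarrow> x = f"
proof -
  have "pt x y \<in> axis_of_symmetry (pt f g) (range (\<lambda>r. pt r h)) \<longleftrightarrow>
      (\<forall>r s. (x - f) * (r - s) = 0)"
    by (simp add: axis_of_symmetry_def orthogonal_to_line_def orthogonal_def inner_diff_pt)
  also have "\<dots> \<longleftrightarrow> x = f"
    by (auto dest: spec[of _ 1] spec[of _ 0])
  finally show ?thesis .
qed

section \<open>The bisector of the right angle\<close>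

text \<open>
  Away from the vertex, the angles with both sides are \<open>\<pi>/4\<close>. With \<open>r\<close> the distance of the point from
  the vertex, this means \<open>- x - y = r\<close> and \<open>x - y = r\<close>.
\<close>

lemma internal_bisector_right_angle:
  assumes "a > 0" "b > 0"
    and X: "pt x y \<in> internal_bisector (pt (-a) (-a)) (pt 0 0) (pt b (-b))"
  shows "x = 0"
proof (cases "pt x y = pt 0 0")
  case False
  let ?r = "norm (pt x y - pt 0 0)"
  have na: "norm (pt (-a) (-a) - pt 0 0) = a * sqrt 2"
    and nb: "norm (pt b (-b) - pt 0 0) = b * sqrt 2"
    using assms(1,2) by (simp_all add: norm_diff_pt real_sqrt_mult)
  have right: "angle_at (pt (-a) (-a)) (pt 0 0) (pt b (-b)) = pi / 2"
    by (simp add: angle_at_def inner_diff_pt)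
  have angles: "angle_at (pt (-a) (-a)) (pt 0 0) (pt x y) = pi / 4"
    "angle_at (pt x y) (pt 0 0) (pt b (-b)) = pi / 4"
    using X False by (auto simp: internal_bisector_def right)
  have cos_angle: "(P - V) \<bullet> (Q - V) = norm (P - V) * norm (Q - V) * cos (angle_at P V Q)"
    if "P \<noteq> V" "Q \<noteq> V" for P V Q
  proof -
    have "\<bar>((P - V) \<bullet> (Q - V)) / (norm (P - V) * norm (Q - V))\<bar> \<le> 1"
      using that Cauchy_Schwarz_ineq2[of "P - V" "Q - V"] by (simp add: abs_mult divide_le_eq)
    then have "cos (angle_at P V Q) = ((P - V) \<bullet> (Q - V)) / (norm (P - V) * norm (Q - V))"
      unfolding angle_at_def by (intro cos_arccos_abs)
    then show ?thesis
      using that by simp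
  qed
  have "- a * x - a * y = a * sqrt 2 * ?r * (sqrt 2 / 2)"
    using cos_angle[of "pt (-a) (-a)" "pt 0 0" "pt x y"] False \<open>a > 0\<close>
    by (simp add: angles inner_diff_pt na cos_45)
  also have "\<dots> = a * ?r"
    by simp
  finally have "a * (- x - y) = a * ?r"
    by (simp add: algebra_simps)
  then have "- x - y = ?r"
    using \<open>a > 0\<close> by simp
  have "b * x - b * y = b * sqrt 2 * ?r * (sqrt 2 / 2)"
    using cos_angle[of "pt x y" "pt 0 0" "pt b (-b)"] False \<open>b > 0\<close>
    by (simp add: angles inner_diff_pt nb cos_45 mult_ac)
  also have "\<dots> = b * ?r"
    by simp
  finally have "b * (x - y) = b * ?r"
    by (simp add: algebra_simps)
  then have "x - y = ?r"
    using \<open>b > 0\<close> by simp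
  with \<open>- x - y = ?r\<close> show "x = 0"
    by simp
qed simp

end

section \<open>The circumcircle of the tangent rectangle\<close>

theorem corollary6:
  fixes C1 C2 C3 u F1 F2 F3 T1 T2 T3 H A1 A3 :: point
    and G1 G2 G3 d1 d2 d3 t1 t3 m1 m3 :: "point set"
  assumes cusps: "C1 \<noteq> C2" "C2 \<noteq> C3" "C1 \<noteq> C3" "C2 \<in> closed_segment C1 C3"
    and parabolas: "is_parabola G1 F1 d1" "is_parabola G2 F2 d2" "is_parabola G3 F3 d3"
    and latera_recta: "is_latus_rectum (closed_segment C1 C2) G1 F1 d1"
      "is_latus_rectum (closed_segment C1 C3) G2 F2 d2"
      "is_latus_rectum (closed_segment C2 C3) G3 F3 d3"
    and same_direction: "opens_towards F1 d1 u" "opens_towards F2 d2 u" "opens_towards F3 d3 u"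
    and tangents: "is_tangent t1 G2 C1" "is_tangent t3 G2 C3"
      "is_tangent m1 G1 C2" "is_tangent m3 G3 C2"
    and tangent_rectangle: "T1 \<in> t1 \<inter> m1" "T2 \<in> t1 \<inter> t3" "T3 \<in> t3 \<inter> m3"
    and H: "H \<in> internal_bisector T1 C2 T3 \<inter> d2"
    and A1: "A1 \<in> axis_of_symmetry F1 d1 \<inter> d3"
    and A3: "A3 \<in> axis_of_symmetry F3 d3 \<inter> d1"
  shows "\<exists>\<Gamma>. is_circle \<Gamma> \<and> {F2, C2, T1, T2, T3} \<subseteq> \<Gamma> \<and>
           (\<forall>\<Gamma>'. is_circle \<Gamma>' \<and> {C2, T1, T2, T3} \<subseteq> \<Gamma>' \<longrightarrow> \<Gamma>' = \<Gamma>) \<and>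
           dist F2 T1 = dist F2 T3 \<and>
           H \<in> \<Gamma> \<and>
           dist H T1 = dist H T3 \<and>
           A1 \<in> \<Gamma> \<and> A3 \<in> \<Gamma> \<and>
           dist A1 C2 = dist A1 T2 \<and> dist A3 C2 = dist A3 T2"
proof -
  obtain t where t: "0 \<le> t" "t \<le> 1" "C2 = (1 - t) *\<^sub>R C1 + t *\<^sub>R C3"
    using cusps(4) by (auto simp: in_segment)
  define l e n where "l = norm (C3 - C1)" and "e = (C3 - C1) /\<^sub>R l" and "n = u /\<^sub>R norm u"
  define a b where "a = t * l / 2" and "b = (1 - t) * l / 2"
  have "l > 0"
    using cusps(3) by (simp add: l_def)
  have "t \<noteq> 0" "t \<noteq> 1"
    using t(3) cusps(1,2) by auto
  then have "a > 0" "b > 0"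
    using t(1,2) \<open>l > 0\<close> by (auto simp: a_def b_def)

  \<comment> \<open>The directrix of \<open>G2\<close> is a translate of the line of the cusps, so \<open>u\<close> is orthogonal to that line.\<close>
  obtain z where z: "\<And>X. X \<in> affine hull {C1, C3} \<Longrightarrow> z + X \<in> d2"
  proof -
    obtain A B where AB: "closed_segment C1 C3 = closed_segment A B"
      "affine_parallel (affine hull {A, B}) d2"
      using latera_recta(2) by (auto simp: is_latus_rectum_def)
    have "{A, B} = {C1, C3}"
      using AB(1) by (simp add: closed_segment_eq)
    then have "affine_parallel (affine hull {C1, C3}) d2"
      using AB(2) by simp
    then show thesis
      using that by (auto simp: affine_parallel_def)
  qed
  have "z + C1 \<in> d2" "z + C3 \<in> d2"
    using z by (auto simp: hull_inc)
  then have "orthogonal u ((z + C3) - (z + C1))" and "u \<bullet> (F2 - (z + C1)) > 0"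
    using same_direction(2) unfolding opens_towards_def orthogonal_to_line_def by blast+
  then have "u \<bullet> (C3 - C1) = 0" and "u \<noteq> 0"
    by (auto simp: orthogonal_def)
  \<comment> \<open>A separate name for the origin: otherwise rewriting \<open>C2\<close> to \<open>pt 0 0\<close> would not terminate, as
    \<open>pt\<close> would itself contain \<open>C2\<close>.\<close>
  obtain Z where Z: "C2 = Z"
    by blast
  interpret frame Z e n
    using \<open>l > 0\<close> \<open>u \<noteq> 0\<close> \<open>u \<bullet> (C3 - C1) = 0\<close>
    by unfold_locales (auto simp: e_def n_def l_def inner_commute)

  have le: "C3 - C1 = l *\<^sub>R e"
    using \<open>l > 0\<close> by (simp add: e_def)
  have "C1 = C2 - t *\<^sub>R (C3 - C1)" "C3 = C2 + (1 - t) *\<^sub>R (C3 - C1)"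
    unfolding t(3) by (simp_all add: algebra_simps)
  then have C: "C1 = pt (- 2 * a) 0" "C2 = pt 0 0" "C3 = pt (2 * b) 0"
    unfolding le by (simp_all add: pt_def a_def b_def Z mult.commute)
  have u: "u = norm u *\<^sub>R n" "norm u > 0"
    using \<open>u \<noteq> 0\<close> by (simp_all add: n_def)

  \<comment> \<open>The cusps as centre plus or minus half-length of each of the three latera recta.\<close>
  have seg: "C1 = pt (- a - a) 0" "C2 = pt (- a + a) 0"
    "C1 = pt ((b - a) - (a + b)) 0" "C3 = pt ((b - a) + (a + b)) 0"
    "C2 = pt (b - b) 0" "C3 = pt (b + b) 0"
    using C by auto
  have "a + b > 0"
    using \<open>a > 0\<close> \<open>b > 0\<close> by simp
  have opens: "opens_towards F1 d1 (norm u *\<^sub>R n)" "opens_towards F2 d2 (norm u *\<^sub>R n)"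
    "opens_towards F3 d3 (norm u *\<^sub>R n)"
    using same_direction u(1) by simp_all
  note par1 = parabola_from_latus_rectum[OF parabolas(1) \<open>a > 0\<close>
      latera_recta(1)[unfolded seg(1,2)] opens(1) u(2)]
  note par2 = parabola_from_latus_rectum[OF parabolas(2) \<open>a + b > 0\<close>
      latera_recta(2)[unfolded seg(3,4)] opens(2) u(2)]
  note par3 = parabola_from_latus_rectum[OF parabolas(3) \<open>b > 0\<close>
      latera_recta(3)[unfolded seg(5,6)] opens(3) u(2)]

  have t1: "pt x y \<in> t1 \<longleftrightarrow> y = - x - 2 * a" for x y
    using tangent_at_latus_rectum_end[OF par2(3) \<open>a + b > 0\<close>, of "- 1" t1 x y] tangents(1)
    by (simp add: C algebra_simps)
  have t3: "pt x y \<in> t3 \<longleftrightarrow> y = x - 2 * b" for x y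
    using tangent_at_latus_rectum_end[OF par2(3) \<open>a + b > 0\<close>, of 1 t3 x y] tangents(2)
    by (simp add: C algebra_simps)
  have m1: "pt x y \<in> m1 \<longleftrightarrow> y = x" for x y
    using tangent_at_latus_rectum_end[OF par1(3) \<open>a > 0\<close>, of 1 m1 x y] tangents(3)
    by (simp add: C algebra_simps)
  have m3: "pt x y \<in> m3 \<longleftrightarrow> y = - x" for x y
    using tangent_at_latus_rectum_end[OF par3(3) \<open>b > 0\<close>, of "- 1" m3 x y] tangents(4)
    by (simp add: C algebra_simps)
  have T1: "T1 = pt (- a) (- a)"
    using tangent_rectangle(1) by (cases rule: pt_cases[of T1]) (auto simp: t1 m1)
  have T2: "T2 = pt (b - a) (- a - b)"
    using tangent_rectangle(2) by (cases rule: pt_cases[of T2]) (auto simp: t1 t3)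
  have T3: "T3 = pt b (- b)"
    using tangent_rectangle(3) by (cases rule: pt_cases[of T3]) (auto simp: t3 m3)
  have A1_eq: "A1 = pt (- a) (- b)"
    using A1 by (cases rule: pt_cases[of A1])
      (auto simp: par1(1,2) par3(2) axis_of_symmetry_horizontal)
  have A3_eq: "A3 = pt b (- a)"
    using A3 by (cases rule: pt_cases[of A3])
      (auto simp: par3(1,2) par1(2) axis_of_symmetry_horizontal)
  obtain x where x: "H = pt x (- a - b)"
    using H by (auto simp: par2(2))
  have "x = 0"
    using internal_bisector_right_angle[OF \<open>a > 0\<close> \<open>b > 0\<close>, of x "- a - b"] H
    by (simp add: x T1 T3 C)
  then have H_eq: "H = pt 0 (- a - b)"
    using x by simp

  \<comment> \<open>The midpoint and half the length of the diagonal \<open>T1 T3\<close>.\<close>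
  define M r where "M = pt ((b - a) / 2) (- (a + b) / 2)" and "r = sqrt ((a\<^sup>2 + b\<^sup>2) / 2)"
  have "r > 0"
    using \<open>a > 0\<close> by (simp add: r_def sum_power2_gt_zero_iff)
  have on_circle: "pt x y \<in> sphere M r \<longleftrightarrow> x\<^sup>2 + y\<^sup>2 = (b - a) * x - (a + b) * y" for x y
  proof -
    have "((b - a) / 2 - x)\<^sup>2 + (- (a + b) / 2 - y)\<^sup>2
        = (a\<^sup>2 + b\<^sup>2) / 2 + (x\<^sup>2 + y\<^sup>2 - ((b - a) * x - (a + b) * y))"
      by (simp add: power2_eq_square field_simps)
    then show ?thesis
      by (simp only: M_def r_def mem_sphere dist_pt real_sqrt_eq_iff
          add_cancel_left_right right_minus_eq)
  qed
  show ?thesis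
  proof (intro exI[of _ "sphere M r"] conjI allI impI)
    show "is_circle (sphere M r)"
      using \<open>r > 0\<close> by (auto simp: is_circle_def)
    show "{F2, C2, T1, T2, T3} \<subseteq> sphere M r" "H \<in> sphere M r" "A1 \<in> sphere M r" "A3 \<in> sphere M r"
      by (simp_all only: insert_subset empty_subsetI par2(1) C T1 T2 T3 H_eq A1_eq A3_eq on_circle)
        (auto simp: power2_eq_square algebra_simps)
    show "dist F2 T1 = dist F2 T3" "dist H T1 = dist H T3"
      "dist A1 C2 = dist A1 T2" "dist A3 C2 = dist A3 T2"
      by (simp_all add: par2(1) C T1 T2 T3 H_eq A1_eq A3_eq dist_pt power2_eq_square algebra_simps)
    fix \<Gamma>'
    assume "is_circle \<Gamma>' \<and> {C2, T1, T2, T3} \<subseteq> \<Gamma>'"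
    then obtain m \<rho> where "\<Gamma>' = sphere m \<rho>" and m: "dist m C2 = \<rho>" "dist m T1 = \<rho>" "dist m T3 = \<rho>"
      by (auto simp: is_circle_def)
    obtain p q where pq: "m = pt p q"
      by (rule pt_cases)
    \<comment> \<open>Three points of the circle already determine the centre.\<close>
    have "p\<^sup>2 + q\<^sup>2 = (p + a)\<^sup>2 + (q + a)\<^sup>2" "p\<^sup>2 + q\<^sup>2 = (p - b)\<^sup>2 + (q + b)\<^sup>2"
      using m by (auto simp: pq C T1 T3 dist_pt)
    then have "2 * a * (p + q + a) = 0" "2 * b * (p - q - b) = 0"
      by (auto simp: power2_eq_square algebra_simps)
    then have "p = (b - a) / 2" "q = - (a + b) / 2"
      using \<open>a > 0\<close> \<open>b > 0\<close> by auto
    then have "m = M"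
      by (simp add: pq M_def)
    moreover have "C2 \<in> sphere M r"
      unfolding C on_circle by simp
    ultimately show "\<Gamma>' = sphere M r"
      using \<open>\<Gamma>' = sphere m \<rho>\<close> m(1) by simp
  qed
qed

end
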